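(* Assume the enhanced-tail same-gauge selector: for every intrinsic package $\mathcal D$ a representative $\zeta_\ast(\mathcal D)\in\Gamma_\Lambda^{\mathrm{int}}$ is fixed, $\mathcal D_\ast:=\mathcal D-\zeta_\ast(\mathcal D)$, and there is $\delta_{\mathrm{sel}}^\sharp\ge0$ such that for all $\mathcal D$ $$\|\mathcal D_\ast\|_{\mathrm{loc,int}}+\alpha_{\mathrm{proj}}\mathcal T_{\mathrm{proj}}(\mathcal D;\zeta_\ast)+\alpha_{\mathrm{harm}}\mathcal T_{\mathrm{harm}}(\mathcal D;\zeta_\ast)\le\operatorname{dist}^{\sharp,\mathrm{tail}}(\mathcal D)+\delta_{\mathrm{sel}}^\sharp.$$ For $a\in\{O,\mathrm{Rep},\mathrm{Tax},\mathrm{Tail}\}$ let $K_{\mathrm{chart}}^a:\mathfrak I_\Lambda^{\mathrm{loc}}\to Y_{\mathrm{chart}}^a$ be bounded linear operators into finite-dimensional normed spaces, with operator norms $C_{\mathrm{chart}}^a$, and define the chart residual $\mathcal R_{\mathrm{chart}}(\mathcal D)=\sum_a\|K_{\mathrm{chart}}^a\mathcal D_\ast\|_{Y_{\mathrm{chart}}^a}$. Set $C_{\mathrm{chart}}=C_{\mathrm{chart}}^O+C_{\mathrm{chart}}^{\mathrm{Rep}}+C_{\mathrm{chart}}^{\mathrm{Tax}}+C_{\mathrm{chart}}^{\mathrm{Tail}}$. Then for every intrinsic package $\mathcal D$, $$\mathcal R_{\mathrm{chart}}(\mathcal D)\le C_{\mathrm{chart}}\operatorname{dist}^{\sharp,\mathrm{tail}}(\mathcal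 D)+C_{\mathrm{chart}}\delta_{\mathrm{sel}}^\sharp,$$ i.e. $\mathcal R_{\mathrm{chart}}(\mathcal D)\le\eta_{\mathrm{chart}}\operatorname{dist}^{\sharp,\mathrm{tail}}(\mathcal D)+\Delta_{\mathrm{chart}}$ with $\eta_{\mathrm{chart}}=C_{\mathrm{chart}}$ and $\Delta_{\mathrm{chart}}=C_{\mathrm{chart}}\delta_{\mathrm{sel}}^\sharp$. If $\zeta_\ast$ is an exact minimizer (so that one may take $\delta_{\mathrm{sel}}^\sharp=0$), then $\Delta_{\mathrm{chart}}=0$.
   Context: Intrinsic packages. $\Lambda$ is a finite set of consecutive integers. For $k\in\Lambda$, $j=1,\dots,7$, let $X_k^{(j)}$ be normed spaces; an intrinsic package is $\mathcal D=(x_k^{(j)})_{k,j}$, $x_k^{(j)}\in X_k^{(j)}$, with norm $\|\mathcal D\|_{\mathrm{loc,int}}^2=\sum_{k}\sum_{j}a_j\|x_k^{(j)}\|^2$, $a_j>0$ fixed; $\mathfrak I_\Lambda^{\mathrm{loc}}$ is the space of intrinsic packages with this norm and $\Gamma_\Lambda^{\mathrm{int}}\subset\mathfrak I_\Lambda^{\mathrm{loc}}$ a linear subspace. Enhanced-tail distance. Let $B_r\subset\mathbb R^3$ be the ball of radius $r$ about $0$, $I=(-1,0)$, $Y_{\mathrm{prs}}=L^{3/2}(I;L^{3/2}(B_{1/2}))$, and $\mathsf R_i$ the Riesz transforms on $\mathbb R^3$ (tensors on $B_1$ are extended by zero, repeated indices summed, results restricted to $B_{1/2}$). Each package $\mathcal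 D$ carries a clean source tensor $F^{\mathrm{cl}}_{ij}(\mathcal D)=U_iU_j+R_{ij}\in L^{3/2}(I;L^{3/2}(B_1))$ built from its clean velocity and covariance coordinates $U,R$, and a harmonic pressure component $p_{\mathrm{harm}}(\mathcal D)$ in a normed space $Y_{\mathrm{harm}}$. $P_{\mathrm{prs},N}^{\mathrm{cl}}$ is a bounded linear projection on $Y_{\mathrm{prs}}$, $\Pi_{\mathrm{harm},M}$ a bounded projection of $Y_{\mathrm{harm}}$ onto a finite-dimensional subspace, $J_{\mathrm{harm}}:Y_{\mathrm{harm}}\to Y_{\mathrm{prs}}$ bounded linear. For $\zeta\in\Gamma_\Lambda^{\mathrm{int}}$, $\mathcal T_{\mathrm{proj}}(\mathcal D;\zeta)=(1+\|P_{\mathrm{prs},N}^{\mathrm{cl}}\|)\|\mathsf R_i\mathsf R_jF_{ij}^{\mathrm{cl}}(\mathcal D-\zeta)\|_{Y_{\mathrm{prs}}}$, $\mathcal T_{\mathrm{harm}}(\mathcal D;\zeta)=\|J_{\mathrm{harm}}\|\,\|(I-\Pi_{\mathrm{harm},M})p_{\mathrm{harm}}(\mathcal D-\zeta)\|_{Y_{\mathrm{harm}}}$. For fixed $\alpha_{\mathrm{proj}},\alpha_{\mathrm{harm}}>0$, $$\operatorname{dist}^{\sharp,\mathrm{tail}}(\mathcal D)=\inf_{\zeta\in\Gamma_\Lambda^{\mathrm{int}}}\big(\|\mathcal D-\zeta\|_{\mathrm{loc,int}}+\alpha_{\mathrm{proj}}\mathcal T_{\mathrm{proj}}(\mathcal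 D;\zeta)+\alpha_{\mathrm{harm}}\mathcal T_{\mathrm{harm}}(\mathcal D;\zeta)\big).$$ *)

theory Defs
  imports "HOL-Analysis.Analysis" "HOL-Library.Function_Algebras"
begin

definition time_measure :: "real measure" where
  "time_measure = restrict_space lborel {-1<..<0}"

definition ball_measure :: "real \<Rightarrow> (real ^ 3) measure" where
  "ball_measure r = restrict_space lborel (ball 0 r)"

abbreviation cyl_measure :: "real \<Rightarrow> (real \<times> (real ^ 3)) measure" where
  "cyl_measure r \<equiv> time_measure \<Otimes>\<^sub>M ball_measure r"

text \<open>
  The 3/2-th power of the norm of \<open>L\<^sup>3\<^sup>/\<^sup>2(I; L\<^sup>3\<^sup>/\<^sup>2(B\<^sub>r))\<close>: the inner integral is
  the 3/2-th power of the norm of the time slice. By separability, Bochner measurability in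
  time amounts to joint measurability of a representative.
\<close>
definition mixed_integral :: "real \<Rightarrow> (real \<times> (real ^ 3) \<Rightarrow> real) \<Rightarrow> ennreal" where
  "mixed_integral r f =
     (\<integral>\<^sup>+ t. (\<integral>\<^sup>+ x. ennreal (\<bar>f (t, x)\<bar> powr (3/2)) \<partial>ball_measure r) \<partial>time_measure)"

definition mixed_norm :: "real \<Rightarrow> (real \<times> (real ^ 3) \<Rightarrow> real) \<Rightarrow> real" where
  "mixed_norm r f = enn2real (mixed_integral r f) powr (2/3)"

definition mixed_space :: "real \<Rightarrow> (real \<times> (real ^ 3) \<Rightarrow> real) set" where
  "mixed_space r = {f \<in> borel_measurable (cyl_measure r). mixed_integral r f < \<infinity>}"

lemma finite_measure_ball_measure: "finite_measure (ball_measure r)"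
proof (rule finite_measureI)
  have "emeasure (ball_measure r) (space (ball_measure r)) = emeasure lborel (ball (0 :: real ^ 3) r)"
    by (simp add: ball_measure_def space_restrict_space emeasure_restrict_space)
  also have "\<dots> < \<infinity>"
    by (rule emeasure_bounded_finite) simp
  finally show "emeasure (ball_measure r) (space (ball_measure r)) \<noteq> \<infinity>" by simp
qed

lemma mixed_integral_eq:
  assumes "f \<in> borel_measurable (cyl_measure r)"
  shows "mixed_integral r f = (\<integral>\<^sup>+ z. ennreal (\<bar>f z\<bar> powr (3/2)) \<partial>cyl_measure r)"
proof -
  interpret finite_measure "ball_measure r" by (rule finite_measure_ball_measure)
  show ?thesis
    unfolding mixed_integral_def using assms
    by (subst nn_integral_fst[symmetric]) auto
qed

lemma powr_convex_combination:
  fixes s t u v p :: real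
  assumes "p \<ge> 1" "s > 0" "t > 0" "s + t = 1" "u \<ge> 0" "v \<ge> 0"
  shows "(s * u + t * v) powr p \<le> s * u powr p + t * v powr p"
proof -
  have aux: "(c * w) powr p \<le> c * w powr p" if "0 < c" "c \<le> 1" "0 \<le> w" for c w :: real
  proof -
    have "c powr p \<le> c powr 1" using that assms(1) by (intro powr_mono') auto
    then show ?thesis using that by (simp add: powr_mult mult_right_mono)
  qed
  consider "u = 0" | "v = 0" | "u > 0" "v > 0" using assms by linarith
  then show ?thesis
  proof cases
    case 3
    then show ?thesis
      using powr_convex[OF assms(1)] assms unfolding convex_on_def by auto
  qed (use aux[of s u] aux[of t v] assms in auto)
qed

lemma mixed_add:
  assumes f: "f \<in> mixed_space r" and g: "g \<in> mixed_space r"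
  shows "(\<lambda>z. f z + g z) \<in> mixed_space r"
    and "mixed_norm r (\<lambda>z. f z + g z) \<le> mixed_norm r f + mixed_norm r g"
proof -
  define F where "F = enn2real (mixed_integral r f)"
  define G where "G = enn2real (mixed_integral r g)"
  have F: "mixed_integral r f = ennreal F" "F \<ge> 0" and G: "mixed_integral r g = ennreal G" "G \<ge> 0"
    using f g by (auto simp: F_def G_def mixed_space_def)
  have meas [measurable]: "f \<in> borel_measurable (cyl_measure r)" "g \<in> borel_measurable (cyl_measure r)"
    using f g by (auto simp: mixed_space_def)
  have bound: "mixed_integral r (\<lambda>z. f z + g z) \<le> ennreal ((a + b) powr (3/2))"
    if a: "a > F powr (2/3)" and b: "b > G powr (2/3)" for a b
  proof -
    have pos: "a > 0" "b > 0" using a b powr_ge_zero[of F "2/3"] powr_ge_zero[of G "2/3"] by linarith+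
    have aF: "F \<le> a powr (3/2)" and bG: "G \<le> b powr (3/2)"
      using powr_mono2[of "3/2" "F powr (2/3)" a] powr_mono2[of "3/2" "G powr (2/3)" b] a b F G
      by (auto simp: powr_powr)
    define c where "c = (a + b) powr (3/2) * (a / (a + b)) / a powr (3/2)"
    define d where "d = (a + b) powr (3/2) * (b / (a + b)) / b powr (3/2)"
    have cd: "c \<ge> 0" "d \<ge> 0" using pos by (auto simp: c_def d_def)
    have sum1: "a / (a + b) + b / (a + b) = 1"
      using pos add_divide_distrib[of a b "a + b"] by simp
    have pt: "\<bar>f z + g z\<bar> powr (3/2) \<le> c * \<bar>f z\<bar> powr (3/2) + d * \<bar>g z\<bar> powr (3/2)" for z
    proof -
      have split1: "(a + b) * (a / (a + b) * (\<bar>f z\<bar> / a)) = \<bar>f z\<bar>"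
        and split2: "(a + b) * (b / (a + b) * (\<bar>g z\<bar> / b)) = \<bar>g z\<bar>"
        using pos by simp_all
      have "\<bar>f z + g z\<bar> powr (3/2) \<le> (\<bar>f z\<bar> + \<bar>g z\<bar>) powr (3/2)" by (intro powr_mono2) auto
      also have "\<bar>f z\<bar> + \<bar>g z\<bar> = (a + b) * (a / (a + b) * (\<bar>f z\<bar> / a) + b / (a + b) * (\<bar>g z\<bar> / b))"
        using split1 split2 by (simp only: distrib_left)
      also have "\<dots> powr (3/2) = (a + b) powr (3/2) * (a / (a + b) * (\<bar>f z\<bar> / a) + b / (a + b) * (\<bar>g z\<bar> / b)) powr (3/2)"
        by (rule powr_mult)
      also have "\<dots> \<le> (a + b) powr (3/2) * (a / (a + b) * (\<bar>f z\<bar> / a) powr (3/2) + b / (a + b) * (\<bar>g z\<bar> / b) powr (3/2))"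
        using pos sum1 by (intro mult_left_mono powr_convex_combination) auto
      also have "\<dots> = c * \<bar>f z\<bar> powr (3/2) + d * \<bar>g z\<bar> powr (3/2)"
        using pos by (simp add: c_def d_def powr_divide algebra_simps)
      finally show ?thesis .
    qed
    have "mixed_integral r (\<lambda>z. f z + g z)
        \<le> (\<integral>\<^sup>+ z. ennreal c * ennreal (\<bar>f z\<bar> powr (3/2)) + ennreal d * ennreal (\<bar>g z\<bar> powr (3/2)) \<partial>cyl_measure r)"
      using pt cd by (subst mixed_integral_eq) (auto intro!: nn_integral_mono simp: ennreal_mult[symmetric] simp flip: ennreal_plus)
    also have "\<dots> = ennreal c * mixed_integral r f + ennreal d * mixed_integral r g"
      by (simp add: nn_integral_add nn_integral_cmult mixed_integral_eq)
    also have "\<dots> = ennreal (c * F + d * G)"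
      using F G cd by (simp add: ennreal_mult)
    also have "\<dots> \<le> ennreal ((a + b) powr (3/2))"
    proof (rule ennreal_leI)
      have "c * F + d * G \<le> c * a powr (3/2) + d * b powr (3/2)"
        using aF bG cd by (intro add_mono mult_left_mono) auto
      also have "\<dots> = (a + b) powr (3/2) * (a / (a + b)) + (a + b) powr (3/2) * (b / (a + b))"
        using pos by (simp add: c_def d_def)
      also have "\<dots> = (a + b) powr (3/2)"
        using pos by (simp flip: distrib_left add_divide_distrib)
      finally show "c * F + d * G \<le> (a + b) powr (3/2)" .
    qed
    finally show ?thesis .
  qed
  have fin: "mixed_integral r (\<lambda>z. f z + g z) < \<infinity>"
    using bound[of "F powr (2/3) + 1" "G powr (2/3) + 1"] ennreal_less_top
    by (auto intro: le_less_trans)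
  then show "(\<lambda>z. f z + g z) \<in> mixed_space r"
    by (auto simp: mixed_space_def)
  have "mixed_norm r (\<lambda>z. f z + g z) \<le> mixed_norm r f + mixed_norm r g + 2 * e" if "e > 0" for e
  proof -
    let ?a = "F powr (2/3) + e" and ?b = "G powr (2/3) + e"
    have "enn2real (mixed_integral r (\<lambda>z. f z + g z)) \<le> (?a + ?b) powr (3/2)"
      using bound[of ?a ?b] that by (intro enn2real_leI) auto
    then have "mixed_norm r (\<lambda>z. f z + g z) \<le> ((?a + ?b) powr (3/2)) powr (2/3)"
      unfolding mixed_norm_def by (intro powr_mono2) auto
    also have "\<dots> = ?a + ?b"
      using that by (simp add: powr_powr)
    finally show ?thesis by (simp add: mixed_norm_def F_def G_def)
  qed
  note eps = this
  show "mixed_norm r (\<lambda>z. f z + g z) \<le> mixed_norm r f + mixed_norm r g"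
  proof (rule field_le_epsilon)
    fix e :: real assume "e > 0"
    then show "mixed_norm r (\<lambda>z. f z + g z) \<le> mixed_norm r f + mixed_norm r g + e"
      using eps[of "e / 2"] by simp
  qed
qed

lemma mixed_scale:
  assumes f: "f \<in> mixed_space r"
  shows "(\<lambda>z. c * f z) \<in> mixed_space r"
    and "mixed_norm r (\<lambda>z. c * f z) = \<bar>c\<bar> * mixed_norm r f"
proof -
  have [measurable]: "f \<in> borel_measurable (cyl_measure r)" using f by (auto simp: mixed_space_def)
  have eq: "mixed_integral r (\<lambda>z. c * f z) = ennreal (\<bar>c\<bar> powr (3/2)) * mixed_integral r f"
    by (simp add: mixed_integral_eq abs_mult powr_mult ennreal_mult nn_integral_cmult)
  show "(\<lambda>z. c * f z) \<in> mixed_space r"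
    using f unfolding mixed_space_def by (auto simp: eq ennreal_mult_less_top)
  show "mixed_norm r (\<lambda>z. c * f z) = \<bar>c\<bar> * mixed_norm r f"
    by (simp add: mixed_norm_def eq enn2real_mult powr_mult powr_powr)
qed

lemma mixed_norm_cong:
  assumes "f \<in> mixed_space r" "g \<in> mixed_space r" "AE z in cyl_measure r. f z = g z"
  shows "mixed_norm r f = mixed_norm r g"
proof -
  have "(\<integral>\<^sup>+ z. ennreal (\<bar>f z\<bar> powr (3/2)) \<partial>cyl_measure r) = (\<integral>\<^sup>+ z. ennreal (\<bar>g z\<bar> powr (3/2)) \<partial>cyl_measure r)"
    using assms(3) by (intro nn_integral_cong_AE) auto
  then show ?thesis using assms(1,2) by (simp add: mixed_norm_def mixed_integral_eq mixed_space_def)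
qed

lemma mixed_zero: "(\<lambda>z. 0) \<in> mixed_space r" "mixed_norm r (\<lambda>z. 0) = 0"
  by (auto simp: mixed_space_def mixed_norm_def mixed_integral_def)

lemma mixed_norm_eq_0:
  assumes "f \<in> mixed_space r"
  shows "mixed_norm r f = 0 \<longleftrightarrow> (AE z in cyl_measure r. f z = 0)"
proof -
  have "f \<in> borel_measurable (cyl_measure r)" "mixed_integral r f < \<infinity>"
    using assms by (auto simp: mixed_space_def)
  then show ?thesis
    by (auto simp: mixed_norm_def enn2real_eq_0_iff mixed_integral_eq nn_integral_0_iff_AE)
qed

text \<open>The pressure space \<open>L\<^sup>3\<^sup>/\<^sup>2(I; L\<^sup>3\<^sup>/\<^sup>2(B\<^sub>1\<^sub>/\<^sub>2))\<close>, functions being identified almost everywhere.\<close>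

definition prs_rel :: "(real \<times> (real ^ 3) \<Rightarrow> real) \<Rightarrow> (real \<times> (real ^ 3) \<Rightarrow> real) \<Rightarrow> bool" where
  "prs_rel f g \<longleftrightarrow> f \<in> mixed_space (1/2) \<and> g \<in> mixed_space (1/2) \<and>
     (AE z in cyl_measure (1/2). f z = g z)"

lemma part_equivp_prs_rel: "part_equivp prs_rel"
proof (rule part_equivpI)
  show "\<exists>f. prs_rel f f" by (auto simp: prs_rel_def intro!: exI[of _ "\<lambda>_. 0"] mixed_zero)
  show "symp prs_rel" by (auto simp: symp_def prs_rel_def elim: eventually_mono)
  show "transp prs_rel"
    by (auto simp: transp_def prs_rel_def elim: eventually_elim2)
qed

quotient_type Y_prs = "real \<times> (real ^ 3) \<Rightarrow> real" / partial: prs_rel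
  by (rule part_equivp_prs_rel)

instantiation Y_prs :: real_normed_vector
begin

lift_definition zero_Y_prs :: Y_prs is "\<lambda>z. 0"
  by (simp add: prs_rel_def mixed_zero)

lift_definition plus_Y_prs :: "Y_prs \<Rightarrow> Y_prs \<Rightarrow> Y_prs" is "\<lambda>f g z. f z + g z"
  by (auto simp: prs_rel_def intro: mixed_add elim: eventually_elim2)

lift_definition scaleR_Y_prs :: "real \<Rightarrow> Y_prs \<Rightarrow> Y_prs" is "\<lambda>c f z. c * f z"
  by (auto simp: prs_rel_def intro: mixed_scale elim: eventually_mono)

lift_definition norm_Y_prs :: "Y_prs \<Rightarrow> real" is "mixed_norm (1/2)"
  by (auto simp: prs_rel_def intro: mixed_norm_cong)

definition uminus_Y_prs :: "Y_prs \<Rightarrow> Y_prs" where "uminus_Y_prs f = (-1) *\<^sub>R f"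
definition minus_Y_prs :: "Y_prs \<Rightarrow> Y_prs \<Rightarrow> Y_prs" where "minus_Y_prs f g = f + (-1) *\<^sub>R g"
definition sgn_Y_prs :: "Y_prs \<Rightarrow> Y_prs" where "sgn_Y_prs f = inverse (norm f) *\<^sub>R f"
definition dist_Y_prs :: "Y_prs \<Rightarrow> Y_prs \<Rightarrow> real" where "dist_Y_prs f g = norm (f - g)"
definition uniformity_Y_prs :: "(Y_prs \<times> Y_prs) filter" where
  "uniformity_Y_prs = (INF e\<in>{0<..}. principal {(f, g). dist f g < e})"
definition open_Y_prs :: "Y_prs set \<Rightarrow> bool" where
  "open_Y_prs S = (\<forall>f\<in>S. \<forall>\<^sub>F (f', g) in uniformity. f' = f \<longrightarrow> g \<in> S)"

instance
proof
  fix f g h :: Y_prs and a b :: real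
  show "f + g + h = f + (g + h)"
    by transfer (auto simp: prs_rel_def add.assoc intro: mixed_add elim: eventually_elim2)
  show "f + g = g + f"
    by transfer (auto simp: prs_rel_def add.commute intro: mixed_add)
  show "0 + f = f"
    by transfer (auto simp: prs_rel_def)
  show "- f + f = 0"
    unfolding uminus_Y_prs_def
    by transfer (auto simp: prs_rel_def mixed_zero)
  show "f - g = f + - g" by (simp add: minus_Y_prs_def uminus_Y_prs_def)
  show "a *\<^sub>R (f + g) = a *\<^sub>R f + a *\<^sub>R g"
    by transfer (auto simp: prs_rel_def distrib_left intro!: mixed_add mixed_scale)
  show "(a + b) *\<^sub>R f = a *\<^sub>R f + b *\<^sub>R f"
    by transfer (auto simp: prs_rel_def distrib_right intro!: mixed_add mixed_scale)
  show "a *\<^sub>R b *\<^sub>R f = (a * b) *\<^sub>R f"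
    by transfer (auto simp: prs_rel_def mult.assoc mixed_scale intro: mixed_scale)
  show "1 *\<^sub>R f = f"
    by transfer (auto simp: prs_rel_def)
  show "norm f = 0 \<longleftrightarrow> f = 0"
    by transfer (auto simp: prs_rel_def mixed_norm_eq_0 mixed_zero)
  show "norm (f + g) \<le> norm f + norm g"
    by transfer (auto simp: prs_rel_def intro: mixed_add)
  show "norm (a *\<^sub>R f) = \<bar>a\<bar> * norm f"
    by transfer (auto simp: prs_rel_def intro: mixed_scale)
qed (auto simp: sgn_Y_prs_def dist_Y_prs_def uniformity_Y_prs_def open_Y_prs_def)

end

lemma norm_abs_Y_prs: "f \<in> mixed_space (1/2) \<Longrightarrow> norm (abs_Y_prs f) = mixed_norm (1/2) f"
  by (rule norm_Y_prs.abs_eq) (simp add: prs_rel_def)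

text \<open>
  The Riesz transforms on \<open>\<real>\<^sup>3\<close> as principal values; the constant is
  \<open>\<Gamma>(2) / \<pi>\<^sup>2\<close>. For \<open>f\<close> in \<open>L\<^sup>3\<^sup>/\<^sup>2\<close> the limit exists almost everywhere, and the
  value of \<open>Lim\<close> on the exceptional null set is immaterial.
\<close>
definition riesz :: "3 \<Rightarrow> (real ^ 3 \<Rightarrow> real) \<Rightarrow> real ^ 3 \<Rightarrow> real" where
  "riesz i f x = Lim (at_right 0)
     (\<lambda>\<epsilon>. 1 / pi\<^sup>2 * (LINT y:{y. \<epsilon> < dist x y}|lborel. (x $ i - y $ i) / dist x y ^ 4 * f y))"

definition double_riesz :: "(3 \<Rightarrow> 3 \<Rightarrow> real \<times> (real ^ 3) \<Rightarrow> real) \<Rightarrow> real \<times> (real ^ 3) \<Rightarrow> real" where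
  "double_riesz F = (\<lambda>(t, x). \<Sum>i\<in>UNIV. \<Sum>j\<in>UNIV.
     riesz i (riesz j (\<lambda>y. if y \<in> ball 0 1 then F i j (t, y) else 0)) x)"

instantiation "fun" :: (type, real_vector) real_vector
begin

definition scaleR_fun :: "real \<Rightarrow> ('a \<Rightarrow> 'b) \<Rightarrow> 'a \<Rightarrow> 'b" where
  "scaleR_fun c f = (\<lambda>x. c *\<^sub>R f x)"

instance
  by standard (auto simp: scaleR_fun_def fun_eq_iff scaleR_add_right scaleR_add_left)

end

definition finite_dim :: "'a::real_vector set \<Rightarrow> bool" where
  "finite_dim S \<longleftrightarrow> (\<exists>B. finite B \<and> span B = S)"

type_synonym 'x package = "int \<Rightarrow> nat \<Rightarrow> 'x"

text \<open>
  The component spaces \<open>X k j\<close> are subspaces, with the induced norm, of one ambient normed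
  space. Any family of normed spaces embeds isometrically in this way into its direct sum,
  so nothing is lost. Packages are extended by zero outside the index set.
\<close>
definition packages :: "int set \<Rightarrow> (int \<Rightarrow> nat \<Rightarrow> 'x::real_normed_vector set) \<Rightarrow> 'x package set" where
  "packages \<Lambda> X = {D. (\<forall>k\<in>\<Lambda>. \<forall>j\<in>{1..7}. D k j \<in> X k j) \<and>
     (\<forall>k j. \<not> (k \<in> \<Lambda> \<and> j \<in> {1..7}) \<longrightarrow> D k j = 0)}"

definition pkg_norm :: "int set \<Rightarrow> (nat \<Rightarrow> real) \<Rightarrow> 'x::real_normed_vector package \<Rightarrow> real" where
  "pkg_norm \<Lambda> a D = sqrt (\<Sum>k\<in>\<Lambda>. \<Sum>j=1..7. a j * (norm (D k j))\<^sup>2)"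

definition pkg_bounded_linear ::
  "int set \<Rightarrow> (int \<Rightarrow> nat \<Rightarrow> 'x::real_normed_vector set) \<Rightarrow> (nat \<Rightarrow> real) \<Rightarrow>
   ('x package \<Rightarrow> 'y::real_normed_vector) \<Rightarrow> bool" where
  "pkg_bounded_linear \<Lambda> X a K \<longleftrightarrow>
     (\<forall>D\<in>packages \<Lambda> X. \<forall>E\<in>packages \<Lambda> X. K (D + E) = K D + K E) \<and>
     (\<forall>c. \<forall>D\<in>packages \<Lambda> X. K (c *\<^sub>R D) = c *\<^sub>R K D) \<and>
     (\<exists>C. \<forall>D\<in>packages \<Lambda> X. norm (K D) \<le> C * pkg_norm \<Lambda> a D)"

text \<open>As in \<^const>\<open>onorm\<close>, the zero package contributes \<open>0 / 0 = 0\<close>.\<close>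
definition pkg_onorm ::
  "int set \<Rightarrow> (int \<Rightarrow> nat \<Rightarrow> 'x::real_normed_vector set) \<Rightarrow> (nat \<Rightarrow> real) \<Rightarrow>
   ('x package \<Rightarrow> 'y::real_normed_vector) \<Rightarrow> real" where
  "pkg_onorm \<Lambda> X a K = (SUP D\<in>packages \<Lambda> X. norm (K D) / pkg_norm \<Lambda> a D)"

definition clean_source ::
  "('x package \<Rightarrow> real \<times> (real ^ 3) \<Rightarrow> real ^ 3) \<Rightarrow>
   ('x package \<Rightarrow> real \<times> (real ^ 3) \<Rightarrow> real ^ 3 ^ 3) \<Rightarrow>
   'x package \<Rightarrow> 3 \<Rightarrow> 3 \<Rightarrow> real \<times> (real ^ 3) \<Rightarrow> real" where
  "clean_source U R D i j z = U D z $ i * U D z $ j + R D z $ i $ j"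

text \<open>The quotient map \<^const>\<open>abs_Y_prs\<close> also restricts to \<open>B\<^sub>1\<^sub>/\<^sub>2\<close>.\<close>
definition T_proj ::
  "(Y_prs \<Rightarrow>\<^sub>L Y_prs) \<Rightarrow>
   ('x::real_normed_vector package \<Rightarrow> real \<times> (real ^ 3) \<Rightarrow> real ^ 3) \<Rightarrow>
   ('x package \<Rightarrow> real \<times> (real ^ 3) \<Rightarrow> real ^ 3 ^ 3) \<Rightarrow>
   'x package \<Rightarrow> 'x package \<Rightarrow> real" where
  "T_proj P U R D \<zeta> =
     (1 + norm P) * norm (abs_Y_prs (double_riesz (clean_source U R (D - \<zeta>))))"

definition T_harm ::
  "('h::real_normed_vector \<Rightarrow>\<^sub>L Y_prs) \<Rightarrow> ('h \<Rightarrow>\<^sub>L 'h) \<Rightarrow>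
   ('x::real_normed_vector package \<Rightarrow> 'h) \<Rightarrow> 'x package \<Rightarrow> 'x package \<Rightarrow> real" where
  "T_harm J Pi_harm p_harm D \<zeta> =
     norm J * norm ((id_blinfun - Pi_harm) (p_harm (D - \<zeta>)))"

definition tail_cost ::
  "int set \<Rightarrow> (nat \<Rightarrow> real) \<Rightarrow> (Y_prs \<Rightarrow>\<^sub>L Y_prs) \<Rightarrow>
   ('x::real_normed_vector package \<Rightarrow> real \<times> (real ^ 3) \<Rightarrow> real ^ 3) \<Rightarrow>
   ('x package \<Rightarrow> real \<times> (real ^ 3) \<Rightarrow> real ^ 3 ^ 3) \<Rightarrow>
   ('h::real_normed_vector \<Rightarrow>\<^sub>L Y_prs) \<Rightarrow> ('h \<Rightarrow>\<^sub>L 'h) \<Rightarrow> ('x package \<Rightarrow> 'h) \<Rightarrow>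
   real \<Rightarrow> real \<Rightarrow> 'x package \<Rightarrow> 'x package \<Rightarrow> real" where
  "tail_cost \<Lambda> a P U R J Pi_harm p_harm \<alpha>_proj \<alpha>_harm D \<zeta> =
     pkg_norm \<Lambda> a (D - \<zeta>) + \<alpha>_proj * T_proj P U R D \<zeta> + \<alpha>_harm * T_harm J Pi_harm p_harm D \<zeta>"

definition tail_dist ::
  "('x package \<Rightarrow> 'x package \<Rightarrow> real) \<Rightarrow> 'x package set \<Rightarrow> 'x package \<Rightarrow> real" where
  "tail_dist cost \<Gamma> D = (INF \<zeta>\<in>\<Gamma>. cost D \<zeta>)"

end

theory Submission
  imports Defs
begin

text \<open>The chart residual and the selected cost are both evaluated at the same remainder
  \<open>D - \<zeta>_sel D\<close>, so no comparison between different gauges is needed. Each chart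
  operator is bounded there by its operator norm times \<open>pkg_norm\<close>
  (\<open>pkg_onorm_bound\<close>), and summing the four bounds produces \<open>C_chart\<close>.
  That norm is one of three nonnegative summands of the cost (\<open>pkg_norm_le_tail_cost\<close>),
  and the selector bounds the cost by the distance plus its defect. Multiplying by
  \<open>C_chart \<ge> 0\<close> gives the estimate; an exact minimizer has defect zero.\<close>

lemma packages_diff:
  assumes "\<And>k j. k \<in> \<Lambda> \<Longrightarrow> j \<in> {1..7} \<Longrightarrow> subspace (X k j)"
    and "D \<in> packages \<Lambda> X" "E \<in> packages \<Lambda> X"
  shows "D - E \<in> packages \<Lambda> X"
  using assms by (auto simp: packages_def intro!: subspace_diff)

lemma pkg_norm_nonneg:
  assumes "\<And>j. j \<in> {1..7} \<Longrightarrow> a j \<ge> 0"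
  shows "pkg_norm \<Lambda> a D \<ge> 0"
  unfolding pkg_norm_def using assms by (auto intro!: sum_nonneg)

text \<open>A real supremum dominates the members of its set only if that set is bounded above; this
  makes \<open>pkg_onorm\<close> a usable operator norm.\<close>

lemma bdd_above_pkg_onorm:
  assumes "\<And>j. j \<in> {1..7} \<Longrightarrow> a j \<ge> 0" and "pkg_bounded_linear \<Lambda> X a K"
  shows "bdd_above ((\<lambda>D. norm (K D) / pkg_norm \<Lambda> a D) ` packages \<Lambda> X)"
proof -
  obtain C where C: "norm (K D) \<le> C * pkg_norm \<Lambda> a D" if "D \<in> packages \<Lambda> X" for D
    using assms(2) unfolding pkg_bounded_linear_def by metis
  \<comment> \<open>The constant \<open>C\<close> may be negative, while a package of norm zero
    contributes the quotient 0; hence the maximum with 0.\<close>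
  have "norm (K D) / pkg_norm \<Lambda> a D \<le> max C 0" if "D \<in> packages \<Lambda> X" for D
    using C[OF that] pkg_norm_nonneg[of a \<Lambda> D, OF assms(1)]
    by (cases "pkg_norm \<Lambda> a D = 0") (auto simp: le_max_iff_disj divide_le_eq)
  then show ?thesis by (intro bdd_aboveI2)
qed

text \<open>Any single quotient is nonnegative and lies below the supremum. Nonemptiness supplies
  such a quotient, as the supremum of the empty set of reals carries no information.\<close>

lemma pkg_onorm_nonneg:
  assumes "\<And>j. j \<in> {1..7} \<Longrightarrow> a j \<ge> 0" and "pkg_bounded_linear \<Lambda> X a K"
    and "packages \<Lambda> X \<noteq> {}"
  shows "pkg_onorm \<Lambda> X a K \<ge> 0"
proof -
  obtain D where D: "D \<in> packages \<Lambda> X" using assms(3) by blast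
  have "0 \<le> norm (K D) / pkg_norm \<Lambda> a D"
    using pkg_norm_nonneg[of a \<Lambda> D, OF assms(1)] by simp
  also have "\<dots> \<le> pkg_onorm \<Lambda> X a K"
    unfolding pkg_onorm_def using D by (rule cSUP_upper[OF _ bdd_above_pkg_onorm[of a, OF assms(1,2)]])
  finally show ?thesis .
qed

lemma pkg_onorm_bound:
  assumes "\<And>j. j \<in> {1..7} \<Longrightarrow> a j \<ge> 0" and "pkg_bounded_linear \<Lambda> X a K"
    and D: "D \<in> packages \<Lambda> X"
  shows "norm (K D) \<le> pkg_onorm \<Lambda> X a K * pkg_norm \<Lambda> a D"
proof (cases "pkg_norm \<Lambda> a D = 0")
  \<comment> \<open>Here the quotient is 0 by the convention for division by zero and says nothing
    about \<open>K D\<close>; boundedness of \<open>K\<close> itself forces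
    \<open>norm (K D) \<le> 0\<close>.\<close>
  case True
  obtain C where "norm (K D) \<le> C * pkg_norm \<Lambda> a D"
    using assms(2) D by (auto simp: pkg_bounded_linear_def)
  then show ?thesis using True by simp
next
  case False
  then have "pkg_norm \<Lambda> a D > 0" using pkg_norm_nonneg[of a \<Lambda> D, OF assms(1)] by simp
  moreover have "norm (K D) / pkg_norm \<Lambda> a D \<le> pkg_onorm \<Lambda> X a K"
    unfolding pkg_onorm_def using D by (rule cSUP_upper[OF _ bdd_above_pkg_onorm[of a, OF assms(1,2)]])
  ultimately show ?thesis by (simp add: divide_le_eq)
qed

lemma T_proj_nonneg: "T_proj P U R D \<zeta> \<ge> 0"
  by (simp add: T_proj_def)

lemma T_harm_nonneg: "T_harm J Pi_harm p_harm D \<zeta> \<ge> 0"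
  by (simp add: T_harm_def)

text \<open>The projection and harmonic tails enter the cost with nonnegative weights and are
  themselves nonnegative, so dropping them only decreases it.\<close>

lemma pkg_norm_le_tail_cost:
  assumes "\<alpha>_proj \<ge> 0" "\<alpha>_harm \<ge> 0"
  shows "pkg_norm \<Lambda> a (D - \<zeta>) \<le> tail_cost \<Lambda> a P U R J Pi_harm p_harm \<alpha>_proj \<alpha>_harm D \<zeta>"
  unfolding tail_cost_def
  using assms mult_nonneg_nonneg[OF assms(1) T_proj_nonneg]
    mult_nonneg_nonneg[OF assms(2) T_harm_nonneg]
  by (smt (verit))

theorem proposition9p116:
  fixes \<Lambda> :: "int set" and m n :: int
    and X :: "int \<Rightarrow> nat \<Rightarrow> 'x::real_normed_vector set"
    and a :: "nat \<Rightarrow> real"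
    and \<Gamma> :: "'x package set"
    and U :: "'x package \<Rightarrow> real \<times> (real ^ 3) \<Rightarrow> real ^ 3"
    and R :: "'x package \<Rightarrow> real \<times> (real ^ 3) \<Rightarrow> real ^ 3 ^ 3"
    and P :: "Y_prs \<Rightarrow>\<^sub>L Y_prs"
    and p_harm :: "'x package \<Rightarrow> 'h::real_normed_vector"
    and Pi_harm :: "'h \<Rightarrow>\<^sub>L 'h"
    and J :: "'h \<Rightarrow>\<^sub>L Y_prs"
    and \<alpha>_proj \<alpha>_harm :: real
    and cost :: "'x package \<Rightarrow> 'x package \<Rightarrow> real"
    and dist_tail :: "'x package \<Rightarrow> real"
    and \<zeta>_sel :: "'x package \<Rightarrow> 'x package"
    and \<delta> :: real
    and K_O :: "'x package \<Rightarrow> 'o::real_normed_vector"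
    and K_Rep :: "'x package \<Rightarrow> 'rep::real_normed_vector"
    and K_Tax :: "'x package \<Rightarrow> 'tax::real_normed_vector"
    and K_Tail :: "'x package \<Rightarrow> 'tail::real_normed_vector"
    and residual :: "'x package \<Rightarrow> real"
    and C_chart \<eta>_chart :: real
    and \<Delta>_chart :: "real \<Rightarrow> real"
  assumes index: "\<Lambda> = {m..n}"
    and spaces: "\<And>k j. k \<in> \<Lambda> \<Longrightarrow> j \<in> {1..7} \<Longrightarrow> subspace (X k j)"
    and weights: "\<And>j. j \<in> {1..7} \<Longrightarrow> a j > 0"
    and gauge: "subspace \<Gamma>" "\<Gamma> \<subseteq> packages \<Lambda> X"
    and source: "\<And>D i j. D \<in> packages \<Lambda> X \<Longrightarrow> clean_source U R D i j \<in> mixed_space 1"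
    and proj_prs: "P o\<^sub>L P = P"
    and proj_harm: "Pi_harm o\<^sub>L Pi_harm = Pi_harm" "finite_dim (range Pi_harm)"
    and alphas: "\<alpha>_proj > 0" "\<alpha>_harm > 0"
    and cost: "cost = tail_cost \<Lambda> a P U R J Pi_harm p_harm \<alpha>_proj \<alpha>_harm"
    and dist_tail: "dist_tail = tail_dist cost \<Gamma>"
    and selector: "\<And>D. D \<in> packages \<Lambda> X \<Longrightarrow> \<zeta>_sel D \<in> \<Gamma>"
      "\<delta> \<ge> 0"
      "\<And>D. D \<in> packages \<Lambda> X \<Longrightarrow> cost D (\<zeta>_sel D) \<le> dist_tail D + \<delta>"
    and chart_ops: "pkg_bounded_linear \<Lambda> X a K_O" "pkg_bounded_linear \<Lambda> X a K_Rep"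
      "pkg_bounded_linear \<Lambda> X a K_Tax" "pkg_bounded_linear \<Lambda> X a K_Tail"
    and chart_dims: "finite_dim (UNIV :: 'o set)" "finite_dim (UNIV :: 'rep set)"
      "finite_dim (UNIV :: 'tax set)" "finite_dim (UNIV :: 'tail set)"
    and residual: "\<And>D. residual D =
        norm (K_O (D - \<zeta>_sel D)) + norm (K_Rep (D - \<zeta>_sel D))
      + norm (K_Tax (D - \<zeta>_sel D)) + norm (K_Tail (D - \<zeta>_sel D))"
    and C_chart: "C_chart = pkg_onorm \<Lambda> X a K_O + pkg_onorm \<Lambda> X a K_Rep
      + pkg_onorm \<Lambda> X a K_Tax + pkg_onorm \<Lambda> X a K_Tail"
    and eta_chart: "\<eta>_chart = C_chart"
    and Delta_chart: "\<And>d. \<Delta>_chart d = C_chart * d"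
  shows "(\<forall>D\<in>packages \<Lambda> X.
        residual D \<le> C_chart * dist_tail D + C_chart * \<delta> \<and>
        residual D \<le> \<eta>_chart * dist_tail D + \<Delta>_chart \<delta>) \<and>
      ((\<forall>D\<in>packages \<Lambda> X. \<forall>\<zeta>\<in>\<Gamma>. cost D (\<zeta>_sel D) \<le> cost D \<zeta>) \<longrightarrow>
        (\<forall>D\<in>packages \<Lambda> X. cost D (\<zeta>_sel D) \<le> dist_tail D + 0) \<and>
        \<Delta>_chart 0 = 0 \<and>
        (\<forall>D\<in>packages \<Lambda> X. residual D \<le> \<eta>_chart * dist_tail D + \<Delta>_chart 0))"
proof -
  have a0: "a j \<ge> 0" if "j \<in> {1..7}" for j
    using weights[OF that] by simp
  \<comment> \<open>The defect \<open>d\<close> is left arbitrary so that one argument serves both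
    \<open>\<delta>\<close> and the exact case \<open>d = 0\<close>.\<close>
  have main: "residual D \<le> C_chart * dist_tail D + C_chart * d"
    if D: "D \<in> packages \<Lambda> X" and sel: "cost D (\<zeta>_sel D) \<le> dist_tail D + d" for D d
  proof -
    define E where "E = D - \<zeta>_sel D"
    have E: "E \<in> packages \<Lambda> X"
      unfolding E_def using spaces D gauge(2) selector(1) by (blast intro: packages_diff)
    then have ne: "packages \<Lambda> X \<noteq> {}" by blast
    \<comment> \<open>The sign is what allows the bound on the norm of \<open>E\<close> to be
      multiplied by \<open>C_chart\<close>.\<close>
    have C0: "C_chart \<ge> 0"
      unfolding C_chart using chart_ops a0 ne by (intro add_nonneg_nonneg pkg_onorm_nonneg)
    have "residual D \<le> C_chart * pkg_norm \<Lambda> a E"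
      unfolding residual C_chart distrib_right E_def[symmetric]
      using chart_ops a0 E by (intro add_mono pkg_onorm_bound)
    also have "pkg_norm \<Lambda> a E \<le> cost D (\<zeta>_sel D)"
      unfolding cost E_def using alphas by (intro pkg_norm_le_tail_cost) auto
    also note sel
    finally show ?thesis using C0 by (simp add: mult_left_mono distrib_left)
  qed
  \<comment> \<open>A lower bound for all costs lies below their infimum; the index set is nonempty
    because the subspace \<open>\<Gamma>\<close> contains 0.\<close>
  have exact: "cost D (\<zeta>_sel D) \<le> dist_tail D"
    if "\<forall>\<zeta>\<in>\<Gamma>. cost D (\<zeta>_sel D) \<le> cost D \<zeta>" for D
    unfolding dist_tail tail_dist_def
    using that subspace_0[OF gauge(1)] by (intro cINF_greatest) auto
  show ?thesis
    using main selector(3) main[where d = 0] exact by (simp add: eta_chart Delta_chart)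
qed

end
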